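(* Let $\langle B_1,S_1\rangle$ and $\langle B_2,S_2\rangle$ be Induction Models. Then $\langle B_1,S_1\rangle$ can be reduced to $\langle B_2,S_2\rangle$ if and only if $n(\langle B_1,S_1\rangle)\le n(\langle B_2,S_2\rangle)$. Moreover, $\langle B_1,S_1\rangle$ and $\langle B_2,S_2\rangle$ are equivalent if and only if $n(\langle B_1,S_1\rangle)=n(\langle B_2,S_2\rangle)$.
   Context: $\mathbb{N}=\{1,2,\dots\}$. An Induction Model (I.M.) is a pair $\langle B,S\rangle$ with $B\subset\mathbb{N}$ and $S:\mathbb{N}^k\to\mathbb{Z}$ for some $k\ge1$. For $A\subseteq\mathbb{N}$ write $S(A)=\{S(x_1,\dots,x_k): x_1,\dots,x_k\in A\}\cap\mathbb{N}$ (entries need not be distinct). Powers: $S^0(B)=B$ and $S^i(B)=\{S(x_1,\dots,x_k): x_1,\dots,x_k\in\bigcup_{j=0}^{i-1}S^j(B)\}\cap\mathbb{N}$ for $i\ge1$. Closures: $Cl_n(\langle B,S\rangle)=\bigcup_{i=0}^n S^i(B)$ and $Cl(\langle B,S\rangle)=\bigcup_{i=0}^\infty S^i(B)$. Difference sets: $D_n(\langle B,S\rangle)=S^n(B)\setminus Cl_{n-1}(\langle B,S\rangle)$ for $n\ge1$. Number of steps: $n(\langle B,S\rangle)=\min\{i\ge1: D_i(\langle B,S\rangle)=\emptyset\}$, and $n(\langle B,S\rangle)=\aleph_0$ if no such $i$ exists (every natural number is $<\aleph_0$). For $x\in Cl(\langle B,S\rangle)$ let $l(x,\langle B,S\rangle)=\min\{i\ge0: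 x\in S^i(B)\}$. An injective version $S_{inj}$ of $S$ is obtained by choosing, for every $x\in Cl(\langle B,S\rangle)\setminus B$, a tuple $\mathbf{n}_x$ with all entries in $Cl_{l(x,\langle B,S\rangle)-1}(\langle B,S\rangle)$ and $S(\mathbf{n}_x)=x$, and setting $S_{inj}(\mathbf{n})=S(\mathbf{n})$ if $\mathbf{n}=\mathbf{n}_x$ for some such $x$, and $S_{inj}(\mathbf{n})=0$ otherwise. Reduction: with $S_1$ $k_1$-ary and $S_2$ $k_2$-ary, $\langle B_1,S_1\rangle$ can be reduced to $\langle B_2,S_2\rangle$ if, for an injective version $S_{2,inj}$ of $S_2$, there is a map $R:Cl(\langle B_2,S_2\rangle)\to 2^{Cl(\langle B_1,S_1\rangle)}$ such that (1) $\bigcup_{x\in Cl(\langle B_2,S_2\rangle)}R(x)=Cl(\langle B_1,S_1\rangle)$; (2) $\bigcup_{x\in B_2}R(x)=B_1$; (3) for every $x\in Cl(\langle B_2,S_2\rangle)\setminus B_2$, writing $x=S_{2,inj}(n_1,\dots,n_{k_2})$ with $(n_1,\dots,n_{k_2})$ the chosen tuple $\mathbf{n}_x$, we have $R(x)=S_1\big(\bigcup_{i=1}^{k_2}R(n_i)\big)\cup\bigcup_{i=1}^{k_2}R(n_i)$. Two I.M.s are equivalent if each can be reduced to the other.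
   Formalization: The reduction claim is stated unless B_2 is empty and B_1 is not, and the equivalence claim unless exactly one base is empty; e.g. B_2 empty, B_1={1}, S_1 constantly 1 gives equal step numbers 1 but no reduction to the second model. *)

theory Defs
  imports Main "HOL-Library.Extended_Nat" "HOL-Library.FuncSet"
begin

(* The paper's natural numbers start at 1, so they are the positive elements of nat.
   A k-ary operation S : N^k -> Z is a function on lists; only its values on lists of
   length k with positive entries are ever used. *)

record ind_model =
  base :: "nat set"
  arity :: nat
  oper :: "nat list \<Rightarrow> int"

definition tuples :: "nat \<Rightarrow> nat set \<Rightarrow> nat list set" where
  "tuples k A = {xs. length xs = k \<and> set xs \<subseteq> A}"

definition induction_model :: "ind_model \<Rightarrow> bool" where
  "induction_model M \<longleftrightarrow> base M \<subseteq> {0<..} \<and> arity M \<ge> 1"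

definition op_image :: "ind_model \<Rightarrow> nat set \<Rightarrow> nat set" where
  "op_image M A = {y. 0 < y \<and> (\<exists>xs \<in> tuples (arity M) A. oper M xs = int y)}"

fun im_pow :: "ind_model \<Rightarrow> nat \<Rightarrow> nat set" where
  "im_pow M 0 = base M"
| "im_pow M (Suc i) = op_image M (\<Union>j\<in>{..i}. im_pow M j)"

definition Cl_upto :: "ind_model \<Rightarrow> nat \<Rightarrow> nat set" where
  "Cl_upto M n = (\<Union>i\<in>{..n}. im_pow M i)"

definition Cl :: "ind_model \<Rightarrow> nat set" where
  "Cl M = (\<Union>i. im_pow M i)"

(* Only meaningful for n >= 1. *)
definition diff_set :: "ind_model \<Rightarrow> nat \<Rightarrow> nat set" where
  "diff_set M n = im_pow M n - Cl_upto M (n - 1)"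

(* aleph_0 is rendered as the top element of enat. *)
definition num_steps :: "ind_model \<Rightarrow> enat" where
  "num_steps M =
     (if \<exists>i\<ge>1. diff_set M i = {} then enat (LEAST i. i \<ge> 1 \<and> diff_set M i = {}) else \<infinity>)"

definition level :: "nat \<Rightarrow> ind_model \<Rightarrow> nat" where
  "level x M = (LEAST i. x \<in> im_pow M i)"

(* t x is the tuple chosen for x; its values outside Cl M - base M are irrelevant. *)
definition tuple_choice :: "ind_model \<Rightarrow> (nat \<Rightarrow> nat list) \<Rightarrow> bool" where
  "tuple_choice M t \<longleftrightarrow>
     (\<forall>x \<in> Cl M - base M.
        t x \<in> tuples (arity M) (Cl_upto M (level x M - 1)) \<and> oper M (t x) = int x)"

definition inj_version :: "ind_model \<Rightarrow> (nat \<Rightarrow> nat list) \<Rightarrow> nat list \<Rightarrow> int" where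
  "inj_version M t ns = (if \<exists>x \<in> Cl M - base M. ns = t x then oper M ns else 0)"

(* For an element x of Cl M - base M, the chosen tuple is the only preimage of x under the
   injective version, so the quantification over ns in the definition of reducible below
   ranges over exactly one tuple. *)
lemma inj_version_eq_iff:
  assumes "induction_model M" "tuple_choice M t" "x \<in> Cl M - base M"
  shows "inj_version M t ns = int x \<longleftrightarrow> ns = t x"
proof -
  have pos: "0 < y" if "y \<in> im_pow M i" for y i
    using that assms(1) by (cases i) (auto simp: induction_model_def op_image_def)
  then have "x \<noteq> 0" using assms(3) by (auto simp: Cl_def)
  then show ?thesis
    using assms(2,3) by (auto simp: inj_version_def tuple_choice_def split: if_splits)
qed

(* M1 can be reduced to M2. *)
definition reducible :: "ind_model \<Rightarrow> ind_model \<Rightarrow> bool" where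
  "reducible M1 M2 \<longleftrightarrow>
     (\<exists>t. tuple_choice M2 t \<and>
       (\<exists>R \<in> Cl M2 \<rightarrow> Pow (Cl M1).
          (\<Union>x\<in>Cl M2. R x) = Cl M1 \<and>
          (\<Union>x\<in>base M2. R x) = base M1 \<and>
          (\<forall>x \<in> Cl M2 - base M2. \<forall>ns \<in> tuples (arity M2) (Cl M2).
             inj_version M2 t ns = int x \<longrightarrow>
               R x = op_image M1 (\<Union>n\<in>set ns. R n) \<union> (\<Union>n\<in>set ns. R n))))"

definition im_equivalent :: "ind_model \<Rightarrow> ind_model \<Rightarrow> bool" where
  "im_equivalent M1 M2 \<longleftrightarrow> reducible M1 M2 \<and> reducible M2 M1"

(* A nonempty base can never be reduced to an empty one, whatever the numbers of steps;
   a comparison of reducibility with numbers of steps has to leave this case out. *)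
lemma not_reducible_empty_base:
  assumes "base M2 = {}" "base M1 \<noteq> {}"
  shows "\<not> reducible M1 M2"
  using assms by (auto simp: reducible_def)

lemma num_steps_empty_base:
  assumes "induction_model M" "base M = {}"
  shows "num_steps M = 1"
proof -
  have "diff_set M 1 = {}"
    using assms by (auto simp: diff_set_def op_image_def tuples_def induction_model_def)
  then have "(LEAST i. i \<ge> 1 \<and> diff_set M i = {}) = 1"
    by (intro Least_equality) auto
  with \<open>diff_set M 1 = {}\<close> show ?thesis
    by (auto simp: num_steps_def one_enat_def)
qed

end

(* Every reduction maps an element of level l into Cl_upto M1 l, so the first model stabilises no
   later than the second one.  Conversely, some entry of the tuple chosen for an element of level
   l + 1 has level exactly l, so R x = Cl_upto M1 (level x M2) satisfies the recursion for any choice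
   of tuples, and it exhausts the closure of the first model because the second model attains every
   level below its number of steps. *)

theory Submission
  imports Defs
begin

section \<open>Stages of the closure\<close>

lemma op_image_mono: "A \<subseteq> B \<Longrightarrow> op_image M A \<subseteq> op_image M B"
  by (fastforce simp: op_image_def tuples_def)

text \<open>The arity is at least 1, so no tuple has all its entries in the empty set.\<close>

lemma op_image_empty: "induction_model M \<Longrightarrow> op_image M {} = {}"
  by (auto simp: op_image_def tuples_def induction_model_def)

lemma Cl_upto_0: "Cl_upto M 0 = base M"
  by (simp add: Cl_upto_def)

lemma im_pow_Suc: "im_pow M (Suc n) = op_image M (Cl_upto M n)"
  by (simp add: Cl_upto_def)

lemma Cl_upto_mono: "m \<le> n \<Longrightarrow> Cl_upto M m \<subseteq> Cl_upto M n"
  by (force simp: Cl_upto_def)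

text \<open>Puts the closure stages into the same shape as the recursion for \<open>R\<close> in
  \<open>reducible\<close>, so that the two can be compared directly.\<close>

lemma Cl_upto_Suc: "Cl_upto M (Suc n) = op_image M (Cl_upto M n) \<union> Cl_upto M n"
  unfolding im_pow_Suc[symmetric] by (auto simp: Cl_upto_def atMost_Suc simp del: im_pow.simps)

lemma Cl_upto_subset_Cl: "Cl_upto M n \<subseteq> Cl M"
  by (auto simp: Cl_upto_def Cl_def)

lemma Cl_eq_Union_Cl_upto: "Cl M = (\<Union>n. Cl_upto M n)"
  by (auto simp: Cl_upto_def Cl_def)

lemma Cl_pos:
  assumes "induction_model M" "x \<in> Cl M"
  shows "0 < x"
proof -
  obtain i where "x \<in> im_pow M i"
    using assms(2) by (auto simp: Cl_def)
  then show ?thesis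
    using assms(1) by (cases i) (auto simp: induction_model_def op_image_def)
qed

section \<open>Levels and stabilisation\<close>

text \<open>The stages are cumulative, and membership in \<open>Cl M\<close> guarantees that the
  \<open>LEAST\<close> in \<open>level\<close> is attained.\<close>

lemma mem_Cl_upto_iff:
  assumes "x \<in> Cl M"
  shows "x \<in> Cl_upto M n \<longleftrightarrow> level x M \<le> n"
proof
  assume "x \<in> Cl_upto M n"
  then obtain i where "i \<le> n" "x \<in> im_pow M i"
    by (auto simp: Cl_upto_def)
  then show "level x M \<le> n"
    unfolding level_def using Least_le[of "\<lambda>i. x \<in> im_pow M i" i] by simp
next
  assume "level x M \<le> n"
  moreover have "x \<in> im_pow M (level x M)"
    using assms unfolding Cl_def level_def by (auto intro: LeastI)
  ultimately show "x \<in> Cl_upto M n"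
    by (auto simp: Cl_upto_def)
qed

lemma level_eq_0_iff: "x \<in> Cl M \<Longrightarrow> level x M = 0 \<longleftrightarrow> x \<in> base M"
  using mem_Cl_upto_iff[of x M 0] by (simp add: Cl_upto_0)

text \<open>A stage closed under the operation absorbs every other stage, by induction on the
  stage.\<close>

lemma Cl_upto_stable:
  assumes "op_image M (Cl_upto M n) \<subseteq> Cl_upto M n"
  shows "Cl M = Cl_upto M n"
proof -
  have "Cl_upto M m \<subseteq> Cl_upto M n" for m
  proof (induction m)
    case 0
    show ?case by (simp add: Cl_upto_mono)
  next
    case (Suc m)
    then show ?case
      using op_image_mono[OF Suc] assms by (auto simp: Cl_upto_Suc)
  qed
  then show ?thesis
    by (auto simp: Cl_eq_Union_Cl_upto)
qed

text \<open>If a single step adds nothing, the stage before it is closed under the operation, hence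
  it is the whole closure.\<close>

lemma diff_set_Suc_empty_iff: "diff_set M (Suc n) = {} \<longleftrightarrow> Cl M = Cl_upto M n"
proof
  assume "diff_set M (Suc n) = {}"
  then show "Cl M = Cl_upto M n"
    by (intro Cl_upto_stable) (simp add: diff_set_def im_pow_Suc del: im_pow.simps)
next
  assume "Cl M = Cl_upto M n"
  then show "diff_set M (Suc n) = {}"
    by (auto simp: diff_set_def Cl_def simp del: im_pow.simps)
qed

text \<open>Replaces the \<open>LEAST\<close> by a condition that is monotone in \<open>n\<close>.
  The shift by one arises because \<open>diff_set M (Suc n)\<close> tests whether stage
  \<open>n\<close> is already complete.\<close>

lemma num_steps_le_Suc_iff: "num_steps M \<le> enat (Suc n) \<longleftrightarrow> Cl M = Cl_upto M n"
proof -
  let ?P = "\<lambda>i. i \<ge> 1 \<and> diff_set M i = {}"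
  show ?thesis
  proof
    assume le: "num_steps M \<le> enat (Suc n)"
    then have ex: "\<exists>i. ?P i"
      by (auto simp: num_steps_def split: if_splits)
    then obtain k where k: "(LEAST i. ?P i) = Suc k" "diff_set M (Suc k) = {}"
      using LeastI_ex[OF ex] by (cases "LEAST i. ?P i") auto
    then have "k \<le> n"
      using le ex by (auto simp: num_steps_def)
    then show "Cl M = Cl_upto M n"
      using k(2) Cl_upto_mono[of k n M] Cl_upto_subset_Cl[of M n]
      by (auto simp: diff_set_Suc_empty_iff)
  next
    assume "Cl M = Cl_upto M n"
    then have P: "?P (Suc n)"
      by (simp add: diff_set_Suc_empty_iff)
    then have "num_steps M = enat (LEAST i. ?P i)"
      unfolding num_steps_def by (meson if_P)
    then show "num_steps M \<le> enat (Suc n)"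
      using Least_le[of ?P, OF P] by simp
  qed
qed

lemma num_steps_pos: "0 < num_steps M"
proof (cases "\<exists>i\<ge>1. diff_set M i = {}")
  case True
  then have "1 \<le> (LEAST i. i \<ge> 1 \<and> diff_set M i = {})"
    using LeastI_ex[of "\<lambda>i. i \<ge> 1 \<and> diff_set M i = {}"] by auto
  with True show ?thesis
    by (simp add: num_steps_def zero_enat_def)
qed (auto simp: num_steps_def)

text \<open>An element of level \<open>Suc n\<close> is missing from stage \<open>n\<close>, so that
  stage is not yet the closure.\<close>

lemma level_less_num_steps:
  assumes "x \<in> Cl M"
  shows "enat (level x M) < num_steps M"
proof (cases "level x M")
  case 0
  then show ?thesis
    using num_steps_pos[of M] by (simp add: zero_enat_def)
next
  case (Suc n)
  then have "x \<notin> Cl_upto M n"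
    using assms by (simp add: mem_Cl_upto_iff)
  then have "\<not> num_steps M \<le> enat (Suc n)"
    using assms by (auto simp: num_steps_le_Suc_iff)
  then show ?thesis
    by (simp add: Suc)
qed

text \<open>Before stabilisation each step adds a new element, whose level is the index of that
  step. The nonempty base provides level 0: for an empty base \<open>num_steps\<close> is 1 although
  no element has level 0.\<close>

lemma level_attained:
  assumes "base M \<noteq> {}" "enat n < num_steps M"
  shows "\<exists>x\<in>Cl M. level x M = n"
proof (cases n)
  case 0
  obtain x where "x \<in> base M"
    using assms(1) by auto
  moreover from this have "x \<in> Cl M"
    using Cl_upto_subset_Cl[of M 0] by (auto simp: Cl_upto_0)
  ultimately show ?thesis
    using 0 level_eq_0_iff by blast
next
  case (Suc k)
  then have "Cl M \<noteq> Cl_upto M k"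
    using assms(2) num_steps_le_Suc_iff[of M k] by (metis not_le)
  then obtain x where x: "x \<in> im_pow M (Suc k)" "x \<notin> Cl_upto M k"
    using diff_set_Suc_empty_iff[of M k] by (auto simp: diff_set_def simp del: im_pow.simps)
  then have "x \<in> Cl M" "x \<in> Cl_upto M (Suc k)"
    by (auto simp: Cl_def Cl_upto_def simp del: im_pow.simps)
  with x(2) have "level x M = Suc k"
    using mem_Cl_upto_iff[of x M k] mem_Cl_upto_iff[of x M "Suc k"] by simp
  with \<open>x \<in> Cl M\<close> show ?thesis
    using Suc by blast
qed

section \<open>Levels of the chosen tuples\<close>

text \<open>An element of level \<open>Suc k\<close> lies in stage \<open>Suc k\<close> but not in
  stage \<open>k\<close>, so it is a value of the operation on stage \<open>k\<close>.\<close>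

lemma ex_tuple_choice: "\<exists>t. tuple_choice M t"
proof -
  have "\<exists>xs. xs \<in> tuples (arity M) (Cl_upto M (level x M - 1)) \<and> oper M xs = int x"
    if x: "x \<in> Cl M - base M" for x
  proof -
    obtain k where k: "level x M = Suc k"
      using x level_eq_0_iff[of x M] by (cases "level x M") auto
    have "x \<in> Cl_upto M (Suc k)" "x \<notin> Cl_upto M k"
      using x k by (simp_all add: mem_Cl_upto_iff)
    then show ?thesis
      by (auto simp: k Cl_upto_Suc op_image_def)
  qed
  then show ?thesis
    unfolding tuple_choice_def by metis
qed

text \<open>If every entry were at least two levels below \<open>x\<close>, the same tuple would
  already produce \<open>x\<close> one stage earlier.\<close>

lemma tuple_choice_levels:
  assumes "induction_model M" "tuple_choice M t" "x \<in> Cl M - base M"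
  shows "\<forall>i\<in>set (t x). i \<in> Cl M \<and> level i M < level x M"
    and "\<exists>i\<in>set (t x). Suc (level i M) = level x M"
proof -
  have pos: "0 < level x M"
    using assms(3) level_eq_0_iff[of x M] by auto
  have t: "t x \<in> tuples (arity M) (Cl_upto M (level x M - 1))" "oper M (t x) = int x"
    using assms(2,3) by (auto simp: tuple_choice_def)
  show less: "\<forall>i\<in>set (t x). i \<in> Cl M \<and> level i M < level x M"
  proof
    fix i assume "i \<in> set (t x)"
    then have i: "i \<in> Cl_upto M (level x M - 1)"
      using t(1) by (auto simp: tuples_def)
    moreover from i have "i \<in> Cl M"
      using Cl_upto_subset_Cl by blast
    ultimately show "i \<in> Cl M \<and> level i M < level x M"
      using pos mem_Cl_upto_iff[of i M "level x M - 1"] by auto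
  qed
  show "\<exists>i\<in>set (t x). Suc (level i M) = level x M"
  proof (rule ccontr)
    assume "\<not> ?thesis"
    then have below: "\<forall>i\<in>set (t x). Suc (level i M) < level x M"
      using less by (metis Suc_lessI)
    \<comment> \<open>The arity is at least 1, so the tuple has an entry; its level forces
      \<open>level x M\<close> to be at least 2, which makes \<open>k\<close> available.\<close>
    obtain i where "i \<in> set (t x)"
      using t(1) assms(1) by (cases "t x") (auto simp: tuples_def induction_model_def)
    then have "Suc (level i M) < level x M"
      using below by blast
    then obtain k where k: "level x M = Suc (Suc k)"
      by (auto dest: less_imp_Suc_add)
    then have "set (t x) \<subseteq> Cl_upto M k"
      using below less by (auto simp: mem_Cl_upto_iff)
    then have "x \<in> op_image M (Cl_upto M k)"
      using t assms(3) Cl_pos[OF assms(1)] by (auto simp: op_image_def tuples_def)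
    then have "x \<in> Cl_upto M (Suc k)"
      by (simp add: Cl_upto_Suc)
    then show False
      using k assms(3) by (simp add: mem_Cl_upto_iff)
  qed
qed

section \<open>Reducibility and the number of steps\<close>

lemma reducible_imp_num_steps_le:
  assumes "induction_model M2" "reducible M1 M2"
  shows "num_steps M1 \<le> num_steps M2"
proof -
  obtain t R where t: "tuple_choice M2 t"
    and R: "(\<Union>x\<in>Cl M2. R x) = Cl M1" "(\<Union>x\<in>base M2. R x) = base M1"
    and step: "\<forall>x\<in>Cl M2 - base M2. \<forall>ns\<in>tuples (arity M2) (Cl M2).
      inj_version M2 t ns = int x \<longrightarrow>
      R x = op_image M1 (\<Union>n\<in>set ns. R n) \<union> (\<Union>n\<in>set ns. R n)"
    using assms(2) unfolding reducible_def by (elim exE conjE bexE) (erule (3) that)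
  \<comment> \<open>The induction is over all smaller levels, because the entries of a chosen tuple
    may lie on different levels below that of \<open>x\<close>.\<close>
  have bound: "R x \<subseteq> Cl_upto M1 (level x M2)" if "x \<in> Cl M2" for x
    using that
  proof (induction "level x M2" arbitrary: x rule: less_induct)
    case less
    show ?case
    proof (cases "x \<in> base M2")
      case True
      then have "R x \<subseteq> base M1"
        using R(2) by auto
      then show ?thesis
        using Cl_upto_mono[of 0 "level x M2" M1] by (auto simp: Cl_upto_0)
    next
      case False
      with less.prems have x: "x \<in> Cl M2 - base M2" by simp
      note lev = tuple_choice_levels[OF assms(1) t x]
      obtain k where k: "level x M2 = Suc k"
        using lev(2) by metis
      have "t x \<in> tuples (arity M2) (Cl M2)"
        using t x lev(1) by (auto simp: tuple_choice_def tuples_def)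
      moreover have "inj_version M2 t (t x) = int x"
        using inj_version_eq_iff[OF assms(1) t x] by simp
      ultimately have Rx: "R x = op_image M1 (\<Union>n\<in>set (t x). R n) \<union> (\<Union>n\<in>set (t x). R n)"
        by (rule step[rule_format, OF x])
      have "R n \<subseteq> Cl_upto M1 k" if "n \<in> set (t x)" for n
      proof -
        have n: "n \<in> Cl M2" "level n M2 < level x M2"
          using lev(1) that by auto
        then have "R n \<subseteq> Cl_upto M1 (level n M2)"
          by (intro less.hyps)
        also have "\<dots> \<subseteq> Cl_upto M1 k"
          using n(2) k by (intro Cl_upto_mono) simp
        finally show ?thesis .
      qed
      then have "(\<Union>n\<in>set (t x). R n) \<subseteq> Cl_upto M1 k"
        by blast
      \<comment> \<open>The recursion for \<open>R x\<close> and the one for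
        \<open>Cl_upto M1 (Suc k)\<close> have the same form, so monotonicity of the operation
        suffices.\<close>
      then show ?thesis
        unfolding Rx k Cl_upto_Suc by (intro Un_mono op_image_mono)
    qed
  qed
  show ?thesis
  proof (cases "num_steps M2")
    case (enat m)
    \<comment> \<open>Levels in \<open>Cl M2\<close> are strictly below \<open>m\<close>, hence at
      most \<open>n\<close>.\<close>
    then obtain n where n: "m = Suc n"
      using num_steps_pos[of M2] by (cases m) (auto simp: zero_enat_def)
    have "R x \<subseteq> Cl_upto M1 n" if "x \<in> Cl M2" for x
      using bound[OF that] level_less_num_steps[OF that] enat n
        Cl_upto_mono[of "level x M2" n M1] by auto
    then have "Cl M1 = Cl_upto M1 n"
      using R(1) Cl_upto_subset_Cl[of M1 n] by blast
    then show ?thesis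
      by (simp add: enat n num_steps_le_Suc_iff)
  qed simp
qed

lemma Cl_upto_empty_base:
  assumes "induction_model M" "base M = {}"
  shows "Cl_upto M n = {}"
  by (induction n) (simp_all add: Cl_upto_0 Cl_upto_Suc assms op_image_empty)

lemma num_steps_le_imp_reducible:
  assumes "induction_model M1" "induction_model M2"
    and base: "base M2 = {} \<longrightarrow> base M1 = {}"
    and le: "num_steps M1 \<le> num_steps M2"
  shows "reducible M1 M2"
proof -
  obtain t where t: "tuple_choice M2 t"
    using ex_tuple_choice by blast
  define R where "R x = Cl_upto M1 (level x M2)" for x
  have cover: "(\<Union>x\<in>Cl M2. R x) = Cl M1"
  proof
    show "(\<Union>x\<in>Cl M2. R x) \<subseteq> Cl M1"
      using Cl_upto_subset_Cl by (auto simp: R_def)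
    show "Cl M1 \<subseteq> (\<Union>x\<in>Cl M2. R x)"
    proof
      fix y assume y: "y \<in> Cl M1"
      \<comment> \<open>An empty base would leave every stage empty. Nonemptiness passes to
        \<open>base M2\<close> through the hypothesis \<open>base\<close>, as
        \<open>level_attained\<close> requires.\<close>
      then have "base M1 \<noteq> {}"
        using Cl_upto_empty_base[OF assms(1)] by (auto simp: Cl_eq_Union_Cl_upto)
      then have "base M2 \<noteq> {}"
        using base by blast
      moreover have "enat (level y M1) < num_steps M2"
        using level_less_num_steps[OF y] le by simp
      ultimately obtain x where "x \<in> Cl M2" "level x M2 = level y M1"
        using level_attained by blast
      then show "y \<in> (\<Union>x\<in>Cl M2. R x)"
        using y mem_Cl_upto_iff[OF y] by (force simp: R_def)
    qed
  qed
  have base_cover: "(\<Union>x\<in>base M2. R x) = base M1"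
  proof -
    have "R x = base M1" if "x \<in> base M2" for x
    proof -
      have "x \<in> Cl M2"
        using that Cl_upto_subset_Cl[of M2 0] by (auto simp: Cl_upto_0)
      then show ?thesis
        using that level_eq_0_iff[of x M2] by (simp add: R_def Cl_upto_0)
    qed
    \<comment> \<open>If \<open>base M2\<close> is empty, the union is empty and the hypothesis
      \<open>base\<close> makes \<open>base M1\<close> empty too.\<close>
    then show ?thesis
      using base by auto
  qed
  have step: "R x = op_image M1 (\<Union>n\<in>set ns. R n) \<union> (\<Union>n\<in>set ns. R n)"
    if x: "x \<in> Cl M2 - base M2" and "inj_version M2 t ns = int x" for x ns
  proof -
    have ns: "ns = t x"
      using that inj_version_eq_iff[OF assms(2) t x] by simp
    note lev = tuple_choice_levels[OF assms(2) t x]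
    obtain i where i: "i \<in> set (t x)" "Suc (level i M2) = level x M2"
      using lev(2) by blast
    \<comment> \<open>The entry \<open>i\<close> has the largest level in the tuple, so
      \<open>R i\<close> absorbs the sets of all other entries and the union is the single stage
      just before that of \<open>x\<close>.\<close>
    have "R n \<subseteq> R i" if "n \<in> set (t x)" for n
      unfolding R_def using lev(1) that i(2) by (intro Cl_upto_mono) (metis less_Suc_eq_le)
    then have "(\<Union>n\<in>set ns. R n) = R i"
      using i(1) ns by blast
    then show ?thesis
      unfolding R_def i(2)[symmetric] Cl_upto_Suc by simp
  qed
  have R: "R \<in> Cl M2 \<rightarrow> Pow (Cl M1)"
    using Cl_upto_subset_Cl by (auto simp: R_def)
  show ?thesis
    unfolding reducible_def
    by (rule exI[of _ t], rule conjI[OF t], rule bexI[OF _ R])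
      (intro conjI cover base_cover ballI impI, rule step)
qed

lemma reducible_iff_num_steps_le:
  assumes "induction_model M1" "induction_model M2" "base M2 = {} \<longrightarrow> base M1 = {}"
  shows "reducible M1 M2 \<longleftrightarrow> num_steps M1 \<le> num_steps M2"
  using reducible_imp_num_steps_le[OF assms(2), of M1] num_steps_le_imp_reducible[OF assms]
  by (rule iffI)

theorem theorem2:
  fixes M1 M2 :: ind_model
  assumes "induction_model M1" and "induction_model M2"
  shows "((base M2 = {} \<longrightarrow> base M1 = {}) \<longrightarrow>
            (reducible M1 M2 \<longleftrightarrow> num_steps M1 \<le> num_steps M2)) \<and>
         ((base M1 = {} \<longleftrightarrow> base M2 = {}) \<longrightarrow>
            (im_equivalent M1 M2 \<longleftrightarrow> num_steps M1 = num_steps M2))"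
  \<comment> \<open>Antisymmetry splits the equality of the numbers of steps into two inequalities;
    simultaneous emptiness of the bases gives the side condition for both directions.\<close>
  using reducible_iff_num_steps_le[OF assms] reducible_iff_num_steps_le[OF assms(2,1)]
  by (simp add: im_equivalent_def order.eq_iff[of "num_steps M1"])

end
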